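(* Let $Z$ be a non-trivial real locally convex linear space, $C \subseteq Z$ a convex cone with $0 \in C$, $\mathcal A \subseteq \mathcal G(Z, C)$, $z^* \in C^+\setminus\{0\}$ and $H^+(z^* ) = \{z \in Z \mid z^*(z) \geq 0\}$. Then $$H^+(z^* ) \ominus \inf \mathcal A = \sup_{A \in \mathcal A}\,[H^+(z^* ) \ominus A],$$ $$H^+(z^* ) \ominus \sup \mathcal A \supseteq \inf_{A \in \mathcal A}\,[H^+(z^* ) \ominus A].$$ If $A \oplus H^+(z^* ) = A$ for all $A \in \mathcal A$ then the second relation is satisfied as an equation.
   Context: $Z^*$ is the topological dual, $C^+ = \{z^* \in Z^* \mid \forall z \in C\colon z^*(z)\ge 0\}$. $\mathcal G(Z,C) = \{A \subseteq Z \mid A = \operatorname{cl}\operatorname{co}(A+C)\}$ (containing $\emptyset$ and $Z$), a complete lattice with respect to $\supseteq$, with $\inf \mathcal A = \operatorname{cl}\operatorname{co}\bigcup_{A \in \mathcal A} A$ and $\sup\mathcal A = \bigcap_{A\in\mathcal A} A$ (and $\inf\emptyset = \emptyset$, $\sup \emptyset = Z$). $A+\emptyset = \emptyset$ and $A \oplus B = \operatorname{cl}(A+B)$. The symbol $\ominus$ denotes the inf-residuation: $A \ominus B = \inf\{D \in \mathcal G(Z,C) \mid B + D \subseteq A\} = \{z \in Z \mid B + z \subseteq A\}$ for $A,B\in\mathcal G(Z,C)$. *)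

theory Defs
  imports "HOL-Analysis.Analysis"
begin

text \<open>Real locally convex spaces; the topology is not required to be Hausdorff.\<close>

class locally_convex_space = real_vector + topological_ab_group_add +
  assumes tendsto_scaleR_nhds:
    "((\<lambda>p. fst p *\<^sub>R snd p) \<longlongrightarrow> c *\<^sub>R a) (nhds (c :: real) \<times>\<^sub>F nhds a)"
  and convex_nhds_base_raw:
    \<comment> \<open>this is \<open>convex V\<close> written out, as \<open>convex\<close> is not available in a class specification\<close>
    "open U \<Longrightarrow> 0 \<in> U \<Longrightarrow> \<exists>V. open V \<and> 0 \<in> V \<and> V \<subseteq> U \<and>
      (\<forall>x\<in>V. \<forall>y\<in>V. \<forall>u\<ge>0. \<forall>v\<ge>0. u + v = 1 \<longrightarrow> u *\<^sub>R x + v *\<^sub>R y \<in> V)"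

lemma convex_nhds_base:
  fixes U :: "'z::locally_convex_space set"
  assumes "open U" "0 \<in> U"
  shows "\<exists>V. open V \<and> convex V \<and> 0 \<in> V \<and> V \<subseteq> U"
  using convex_nhds_base_raw[OF assms] unfolding convex_def by blast

instance real_normed_vector \<subseteq> locally_convex_space
proof
  fix c :: real and a :: 'a
  show "((\<lambda>p. fst p *\<^sub>R snd p) \<longlongrightarrow> c *\<^sub>R a) (nhds c \<times>\<^sub>F nhds a)"
    by (intro tendsto_scaleR filterlim_fst filterlim_snd)
next
  fix U :: "'a set" assume "open U" "0 \<in> U"
  then obtain e where e: "e > 0" "ball 0 e \<subseteq> U"
    using open_contains_ball by blast
  then show "\<exists>V. open V \<and> 0 \<in> V \<and> V \<subseteq> U \<and>
      (\<forall>x\<in>V. \<forall>y\<in>V. \<forall>u\<ge>0. \<forall>v\<ge>0. u + v = 1 \<longrightarrow> u *\<^sub>R x + v *\<^sub>R y \<in> V)"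
    using convex_ball[of "0::'a" e] unfolding convex_def by (intro exI[of _ "ball 0 e"]) auto
qed

definition topological_dual :: "('z::locally_convex_space \<Rightarrow> real) set" where
  "topological_dual = {f. linear f \<and> continuous_on UNIV f}"

definition dual_cone :: "'z::locally_convex_space set \<Rightarrow> ('z \<Rightarrow> real) set" where
  "dual_cone C = {f \<in> topological_dual. \<forall>z\<in>C. f z \<ge> 0}"

definition pos_halfspace :: "('z::locally_convex_space \<Rightarrow> real) \<Rightarrow> 'z set" where
  "pos_halfspace f = {z. f z \<ge> 0}"

text \<open>Below, \<open>+\<close> on sets is the Minkowski sum, so that \<open>A + {} = {}\<close>.\<close>

definition upper_sets :: "'z::locally_convex_space set \<Rightarrow> 'z set set" where
  "upper_sets C = {A. A = closure (convex hull (A + C))}"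

definition cl_sum :: "'z::locally_convex_space set \<Rightarrow> 'z set \<Rightarrow> 'z set" where
  "cl_sum A B = closure (A + B)"

text \<open>
  Infimum and supremum in \<open>upper_sets C\<close> ordered by \<open>\<supseteq>\<close>. The convention for the empty
  family (\<open>inf {} = {}\<close>, \<open>sup {} = UNIV\<close>) comes out of the formulas.
\<close>

definition set_inf :: "'z::locally_convex_space set set \<Rightarrow> 'z set" where
  "set_inf \<A> = closure (convex hull (\<Union>\<A>))"

definition set_sup :: "'z::locally_convex_space set set \<Rightarrow> 'z set" where
  "set_sup \<A> = \<Inter>\<A>"

definition inf_residual ::
    "'z::locally_convex_space set \<Rightarrow> 'z set \<Rightarrow> 'z set \<Rightarrow> 'z set" where
  "inf_residual C A B = set_inf {D \<in> upper_sets C. B + D \<subseteq> A}"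

lemma tendsto_scaleR_lcs:
  fixes g :: "'b \<Rightarrow> 'z::locally_convex_space"
  assumes "(f \<longlongrightarrow> c) F" "(g \<longlongrightarrow> a) F"
  shows "((\<lambda>x. f x *\<^sub>R g x) \<longlongrightarrow> c *\<^sub>R a) F"
  using filterlim_compose[OF tendsto_scaleR_nhds filterlim_Pair[OF assms]] by simp

lemma closed_image_translate_lcs:
  fixes S :: "'z::locally_convex_space set"
  assumes "closed S"
  shows "closed {z. b + z \<in> S}"
proof -
  have "closed ((\<lambda>z. b + z) -` S)"
    by (intro closed_vimage assms continuous_intros)
  then show ?thesis by (simp add: vimage_def)
qed

lemma closure_add_subset_lcs:
  fixes S T U :: "'z::locally_convex_space set"
  assumes "S + T \<subseteq> U" "closed U"
  shows "closure S + closure T \<subseteq> U"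
proof -
  have 1: "b + z \<in> U" if "b \<in> S" "z \<in> closure T" for b z
  proof -
    have "T \<subseteq> {z. b + z \<in> U}" using assms(1) that by (auto simp: set_plus_def)
    then have "closure T \<subseteq> {z. b + z \<in> U}"
      by (rule closure_minimal[OF _ closed_image_translate_lcs[OF assms(2)]])
    then show ?thesis using that by auto
  qed
  have 2: "b + z \<in> U" if "b \<in> closure S" "z \<in> closure T" for b z
  proof -
    have "S \<subseteq> {b. z + b \<in> U}" using 1 that by (auto simp: add.commute)
    then have "closure S \<subseteq> {b. z + b \<in> U}"
      by (rule closure_minimal[OF _ closed_image_translate_lcs[OF assms(2)]])
    then show ?thesis using that by (auto simp: add.commute)
  qed
  then show ?thesis by (auto simp: set_plus_def)
qed

lemma convex_closure_lcs:
  fixes S :: "'z::locally_convex_space set"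
  assumes "convex S"
  shows "convex (closure S)"
proof (rule convexI)
  fix x y :: 'z and u v :: real
  assume xy: "x \<in> closure S" "y \<in> closure S" and uv: "0 \<le> u" "0 \<le> v" "u + v = 1"
  have cont: "continuous_on UNIV (\<lambda>z::'z. w *\<^sub>R z)" for w :: real
    unfolding continuous_on_def by (intro ballI tendsto_scaleR_lcs tendsto_const tendsto_ident_at)
  have sc: "w *\<^sub>R x \<in> closure ((*\<^sub>R) w ` S)" if "x \<in> closure S" for w :: real and x :: 'z
  proof -
    have "(*\<^sub>R) w ` closure S \<subseteq> closure ((*\<^sub>R) w ` S)"
      by (rule image_closure_subset[OF continuous_on_subset[OF cont subset_UNIV]
            closed_closure closure_subset])
    then show ?thesis using that by blast
  qed
  have "(*\<^sub>R) u ` S + (*\<^sub>R) v ` S \<subseteq> closure S"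
  proof -
    have "u *\<^sub>R a + v *\<^sub>R b \<in> closure S" if "a \<in> S" "b \<in> S" for a b
      using convexD[OF assms that uv] closure_subset[of S] by blast
    then show ?thesis by (auto simp: set_plus_def)
  qed
  from closure_add_subset_lcs[OF this closed_closure]
  show "u *\<^sub>R x + v *\<^sub>R y \<in> closure S"
    using sc xy by (blast intro: set_plus_intro)
qed

lemma upper_sets_iff:
  fixes A C :: "'z::locally_convex_space set"
  assumes "convex C" "0 \<in> C"
  shows "A \<in> upper_sets C \<longleftrightarrow> closed A \<and> convex A \<and> A + C \<subseteq> A"
proof
  assume "A \<in> upper_sets C"
  then have A: "A = closure (convex hull (A + C))" by (simp add: upper_sets_def)
  have "closed A" "convex A"
    using convex_closure_lcs[OF convex_convex_hull, of "A + C"]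
      closed_closure[of "convex hull (A + C)"] A by simp_all
  moreover have "A + C \<subseteq> A"
    using hull_subset[of "A + C" convex] closure_subset[of "convex hull (A + C)"] A by auto
  ultimately show "closed A \<and> convex A \<and> A + C \<subseteq> A" by simp
next
  assume r: "closed A \<and> convex A \<and> A + C \<subseteq> A"
  have "A \<subseteq> A + C" using set_plus_intro[OF _ assms(2), of _ A] by auto
  with r have "A + C = A" by (intro antisym) auto
  then show "A \<in> upper_sets C" using r by (simp add: upper_sets_def hull_same)
qed

text \<open>\<open>set_inf\<close> and \<open>set_sup\<close> are the lattice operations of \<open>upper_sets C\<close> with respect to \<open>\<supseteq>\<close>.\<close>

lemma set_inf_lower: "A \<in> \<A> \<Longrightarrow> A \<subseteq> set_inf \<A>"
  unfolding set_inf_def by (meson Union_upper closure_subset hull_subset order_trans)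

lemma set_inf_greatest:
  fixes B :: "'z::locally_convex_space set"
  assumes "convex C" "0 \<in> C" "B \<in> upper_sets C" "\<And>A. A \<in> \<A> \<Longrightarrow> A \<subseteq> B"
  shows "set_inf \<A> \<subseteq> B"
  unfolding set_inf_def using assms upper_sets_iff[of C B]
  by (simp add: closure_minimal hull_minimal Sup_least)

lemma set_inf_in:
  fixes C :: "'z::locally_convex_space set"
  assumes "convex C" "0 \<in> C" "\<A> \<subseteq> upper_sets C"
  shows "set_inf \<A> \<in> upper_sets C"
proof -
  have U: "\<Union>\<A> + C \<subseteq> \<Union>\<A>"
  proof
    fix z assume "z \<in> \<Union>\<A> + C"
    then obtain A a c where *: "A \<in> \<A>" "a \<in> A" "c \<in> C" "z = a + c"
      by (auto simp: set_plus_def)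
    then have "A + C \<subseteq> A" using assms(3) upper_sets_iff[OF assms(1,2)] by blast
    then have "z \<in> A" using * set_plus_intro[of a A c C] by auto
    then show "z \<in> \<Union>\<A>" using * by blast
  qed
  have "convex hull (\<Union>\<A>) + C \<subseteq> convex hull (\<Union>\<A>)"
    using hull_mono[OF U, of convex] convex_hull_set_plus[of "\<Union>\<A>" C] hull_same[of convex C]
      assms(1) by simp
  then have "convex hull (\<Union>\<A>) + C \<subseteq> set_inf \<A>"
    unfolding set_inf_def using closure_subset by blast
  then have "closure (convex hull (\<Union>\<A>)) + closure C \<subseteq> set_inf \<A>"
    by (rule closure_add_subset_lcs) (simp add: set_inf_def)
  then have "set_inf \<A> + C \<subseteq> set_inf \<A>"
    using set_plus_mono2[OF order_refl closure_subset[of C]] by (fastforce simp: set_inf_def)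
  then show ?thesis
    by (simp add: upper_sets_iff[OF assms(1,2)] set_inf_def convex_closure_lcs)
qed

lemma set_sup_in:
  fixes C :: "'z::locally_convex_space set"
  assumes "convex C" "0 \<in> C" "\<A> \<subseteq> upper_sets C"
  shows "set_sup \<A> \<in> upper_sets C"
proof -
  have up: "closed A" "convex A" "A + C \<subseteq> A" if "A \<in> \<A>" for A
    using that assms(3) upper_sets_iff[OF assms(1,2)] by blast+
  have "a + c \<in> A" if "a \<in> \<Inter>\<A>" "c \<in> C" "A \<in> \<A>" for a c A
    using up(3)[OF that(3)] set_plus_intro[of a A c C] that by blast
  then have "\<Inter>\<A> + C \<subseteq> \<Inter>\<A>" by (auto simp: set_plus_def)
  then show ?thesis
    unfolding set_sup_def upper_sets_iff[OF assms(1,2)]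
    using up by (simp add: closed_Inter convex_Inter)
qed

lemma inf_residual_eq:
  fixes A B C :: "'z::locally_convex_space set"
  assumes C: "convex C" "0 \<in> C" and A: "A \<in> upper_sets C"
  shows "inf_residual C A B = {z. \<forall>b\<in>B. b + z \<in> A}"
proof -
  define E where "E = {d. \<forall>b\<in>B. b + d \<in> A}"
  have A': "closed A" "convex A" "A + C \<subseteq> A" using upper_sets_iff[OF C] A by auto
  have "E = (\<Inter>b\<in>B. {d. b + d \<in> A})" by (auto simp: E_def)
  then have "closed E" using closed_image_translate_lcs[OF A'(1)] by (auto intro: closed_INT)
  moreover have "convex E"
  proof (rule convexI)
    fix x y :: 'z and u v :: real
    assume h: "x \<in> E" "y \<in> E" "0 \<le> u" "0 \<le> v" "u + v = 1"
    have "b + (u *\<^sub>R x + v *\<^sub>R y) \<in> A" if "b \<in> B" for b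
    proof -
      have "u *\<^sub>R (b + x) + v *\<^sub>R (b + y) \<in> A"
        using h that A'(2) by (simp add: convex_def E_def)
      moreover have "u *\<^sub>R (b + x) + v *\<^sub>R (b + y) = (u + v) *\<^sub>R b + (u *\<^sub>R x + v *\<^sub>R y)"
        by (simp add: algebra_simps)
      ultimately show ?thesis using h(5) by simp
    qed
    then show "u *\<^sub>R x + v *\<^sub>R y \<in> E" by (simp add: E_def)
  qed
  moreover have "E + C \<subseteq> E"
  proof -
    have "b + (d + c) \<in> A" if "d \<in> E" "c \<in> C" "b \<in> B" for b c d
      using A'(3) set_plus_intro[of "b + d" A c C] that by (auto simp: E_def add.assoc)
    then show ?thesis by (auto simp: set_plus_def E_def)
  qed
  ultimately have E: "E \<in> upper_sets C" by (simp add: upper_sets_iff[OF C])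
  moreover have "B + E \<subseteq> A" by (auto simp: E_def set_plus_def)
  ultimately have "E \<subseteq> inf_residual C A B"
    unfolding inf_residual_def by (intro set_inf_lower) simp
  moreover have "inf_residual C A B \<subseteq> E"
    unfolding inf_residual_def by (rule set_inf_greatest[OF C E]) (auto simp: E_def set_plus_def)
  ultimately show ?thesis by (simp add: E_def)
qed

end

theory Submission
  imports Defs
begin

text \<open>
  The first two relations hold for every minuend \<open>H\<close> in \<open>upper_sets C\<close>: the set of all \<open>b\<close> with
  \<open>b + z \<in> H\<close> is closed and convex, and residuation is antitone in the subtrahend. For the
  equality, fix \<open>e\<close> with \<open>zs e = 1\<close> and let \<open>z\<close> belong to the residual of the supremum. If
  \<open>z + \<epsilon> *\<^sub>R e\<close> lay in no residual of a member of the family, then every member would contain a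
  point with \<open>zs\<close>-value below \<open>- zs z - \<epsilon>\<close>, hence, being stable under adding the halfspace,
  also \<open>- (zs z + \<epsilon>) *\<^sub>R e\<close>. This common point contradicts the choice of \<open>z\<close>; now let
  \<open>\<epsilon>\<close> tend to \<open>0\<close>.
\<close>

lemma inf_residual_in:
  assumes "convex C" "0 \<in> C"
  shows "inf_residual C A B \<in> upper_sets C"
  unfolding inf_residual_def using assms by (intro set_inf_in) auto

lemma inf_residual_set_inf:
  assumes C: "convex C" "0 \<in> C" and H: "H \<in> upper_sets C"
  shows "inf_residual C H (set_inf \<A>) = set_sup (inf_residual C H ` \<A>)"
proof (intro antisym subsetI)
  fix z assume "z \<in> inf_residual C H (set_inf \<A>)"
  then show "z \<in> set_sup (inf_residual C H ` \<A>)"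
    using set_inf_lower by (fastforce simp: set_sup_def inf_residual_eq[OF C H])
next
  fix z assume z: "z \<in> set_sup (inf_residual C H ` \<A>)"
  \<comment> \<open>\<open>?S\<close> is the translate of \<open>H\<close> by \<open>- z\<close>. A
    closed convex set that contains every member of \<open>\<A>\<close> also contains the closed
    convex hull of their union.\<close>
  let ?S = "{b. z + b \<in> H}"
  have H': "closed H" "convex H" using H upper_sets_iff[OF C] by auto
  have "?S = (\<lambda>b. - z + b) ` H"
  proof (intro set_eqI iffI)
    fix b assume "b \<in> ?S"
    then show "b \<in> (\<lambda>b. - z + b) ` H" by (intro image_eqI[of _ _ "z + b"]) simp_all
  qed auto
  then have "convex ?S" using convex_translation[OF H'(2), of "- z"] by simp
  moreover have "\<Union>\<A> \<subseteq> ?S"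
    using z by (auto simp: set_sup_def inf_residual_eq[OF C H] add.commute)
  ultimately have "set_inf \<A> \<subseteq> ?S"
    unfolding set_inf_def
    by (intro closure_minimal hull_minimal closed_image_translate_lcs H'(1))
  then show "z \<in> inf_residual C H (set_inf \<A>)"
    by (auto simp: inf_residual_eq[OF C H] add.commute)
qed

lemma set_inf_residual_subset:
  assumes C: "convex C" "0 \<in> C" and H: "H \<in> upper_sets C"
  shows "set_inf (inf_residual C H ` \<A>) \<subseteq> inf_residual C H (set_sup \<A>)"
proof (rule set_inf_greatest[OF C inf_residual_in[OF C]])
  fix D assume "D \<in> inf_residual C H ` \<A>"
  then show "D \<subseteq> inf_residual C H (set_sup \<A>)"
    by (auto simp: set_sup_def inf_residual_eq[OF C H])
qed

text \<open>Nonnegativity of \<open>f\<close> on \<open>C\<close> is what makes the halfspace stable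
  under adding \<open>C\<close>. The halfspace may thus serve as the minuend in the pointwise
  description of the residual.\<close>

lemma pos_halfspace_in_upper_sets:
  assumes C: "convex C" "0 \<in> C" and f: "f \<in> dual_cone C"
  shows "pos_halfspace f \<in> upper_sets C"
proof -
  have lin: "linear f" and cont: "continuous_on UNIV f" and nonneg: "\<And>c. c \<in> C \<Longrightarrow> 0 \<le> f c"
    using f by (auto simp: dual_cone_def topological_dual_def)
  have "closed (pos_halfspace f)"
    unfolding pos_halfspace_def by (intro closed_Collect_le continuous_on_const cont)
  moreover have "convex (pos_halfspace f)"
    by (auto simp: pos_halfspace_def convex_def linear_add[OF lin] linear_scale[OF lin])
  moreover have "pos_halfspace f + C \<subseteq> pos_halfspace f"
    using nonneg by (auto simp: pos_halfspace_def set_plus_def linear_add[OF lin])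
  ultimately show ?thesis by (simp add: upper_sets_iff[OF C])
qed

text \<open>The difference \<open>b - a\<close> lies in the halfspace, so
  \<open>b = a + (b - a)\<close> is already in the sum before closing.\<close>

lemma mem_if_cl_sum_halfspace:
  assumes lin: "linear f" and A: "cl_sum A (pos_halfspace f) = A"
    and a: "a \<in> A" and le: "f a \<le> f b"
  shows "b \<in> A"
proof -
  have "b - a \<in> pos_halfspace f"
    using le by (simp add: pos_halfspace_def linear_diff[OF lin])
  then have "a + (b - a) \<in> A + pos_halfspace f" by (intro set_plus_intro a)
  then show ?thesis using A closure_subset by (auto simp: cl_sum_def)
qed

lemma residual_set_sup_subset:
  assumes C: "convex C" "0 \<in> C" and f: "f \<in> dual_cone C" "f \<noteq> (\<lambda>_. 0)"
    and cl: "\<And>A. A \<in> \<A> \<Longrightarrow> cl_sum A (pos_halfspace f) = A"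
  shows "inf_residual C (pos_halfspace f) (set_sup \<A>)
    \<subseteq> set_inf (inf_residual C (pos_halfspace f) ` \<A>)"
proof
  fix z assume z: "z \<in> inf_residual C (pos_halfspace f) (set_sup \<A>)"
  let ?U = "\<Union>(inf_residual C (pos_halfspace f) ` \<A>)"
  have mem: "z \<in> inf_residual C (pos_halfspace f) B \<longleftrightarrow> (\<forall>b\<in>B. 0 \<le> f (b + z))" for z B
    using inf_residual_eq[OF C pos_halfspace_in_upper_sets[OF C f(1)]]
    by (simp add: pos_halfspace_def)
  have lin: "linear f" using f by (simp add: dual_cone_def topological_dual_def)
  obtain y where "f y \<noteq> 0" using f(2) by auto
  then obtain e where e: "f e = 1"
    using that[of "inverse (f y) *\<^sub>R y"] by (simp add: linear_scale[OF lin])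
  \<comment> \<open>The slack \<open>\<epsilon>\<close> keeps the values found in different members
    uniformly below \<open>- f z\<close>, so that one point can serve for all of them. An empty
    family is covered: its supremum is the whole space.\<close>
  have step: "z + \<epsilon> *\<^sub>R e \<in> ?U" if "\<epsilon> > 0" for \<epsilon>
  proof (rule ccontr)
    assume "z + \<epsilon> *\<^sub>R e \<notin> ?U"
    then have low: "\<exists>a\<in>A. f (a + (z + \<epsilon> *\<^sub>R e)) < 0" if "A \<in> \<A>" for A
      using that by (simp add: mem not_le)
    \<comment> \<open>The multiple of \<open>e\<close> is chosen so that
      \<open>f (?b + z) = - \<epsilon>\<close>.\<close>
    let ?b = "- (f z + \<epsilon>) *\<^sub>R e"
    have fb: "f ?b = - (f z + \<epsilon>)" by (simp only: linear_scale[OF lin] e real_scaleR_def mult_1_right)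
    have "?b \<in> A" if A: "A \<in> \<A>" for A
    proof -
      obtain a where a: "a \<in> A" "f (a + (z + \<epsilon> *\<^sub>R e)) < 0" using low[OF A] by blast
      then have "f a \<le> f ?b"
        unfolding fb by (simp add: linear_add[OF lin] linear_scale[OF lin] e)
      then show ?thesis by (rule mem_if_cl_sum_halfspace[OF lin cl[OF A] a(1)])
    qed
    then have "?b \<in> set_sup \<A>" by (simp add: set_sup_def)
    then have "f (?b + z) \<ge> 0" using z by (simp add: mem)
    then show False using \<open>\<epsilon> > 0\<close> unfolding linear_add[OF lin] fb by simp
  qed
  \<comment> \<open>Take \<open>\<epsilon> = 1 / (n + 1)\<close>; continuity of scalar
    multiplication gives the limit \<open>z\<close>. The closure of the union alone captures it,
    without convex combinations.\<close>
  have lim: "((\<lambda>n. z + inverse (real (Suc n)) *\<^sub>R e) \<longlongrightarrow> z + 0 *\<^sub>R e) sequentially"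
    by (rule tendsto_add[OF tendsto_const
          tendsto_scaleR_lcs[OF LIMSEQ_inverse_real_of_nat tendsto_const]])
  have "\<forall>\<^sub>F n in sequentially. z + inverse (real (Suc n)) *\<^sub>R e \<in> closure ?U"
    by (intro always_eventually allI subsetD[OF closure_subset] step) simp
  then have "z + 0 *\<^sub>R e \<in> closure ?U"
    by (rule Lim_in_closed_set[OF closed_closure _ sequentially_bot lim])
  moreover have "closure ?U \<subseteq> set_inf (inf_residual C (pos_halfspace f) ` \<A>)"
    unfolding set_inf_def by (intro closure_mono hull_subset)
  ultimately show "z \<in> set_inf (inf_residual C (pos_halfspace f) ` \<A>)" by auto
qed

theorem proposition4p16:
  fixes C :: "'z::locally_convex_space set"
    and \<A> :: "'z set set"
    and zs :: "'z \<Rightarrow> real"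
  assumes nontrivial: "\<exists>z::'z. z \<noteq> 0"
    and C: "convex_cone C" "0 \<in> C"
    and \<A>: "\<A> \<subseteq> upper_sets C"
    and zs: "zs \<in> dual_cone C - {\<lambda>_. 0}"
  shows "inf_residual C (pos_halfspace zs) (set_inf \<A>)
           = set_sup ((\<lambda>A. inf_residual C (pos_halfspace zs) A) ` \<A>)
       \<and> inf_residual C (pos_halfspace zs) (set_sup \<A>)
           \<supseteq> set_inf ((\<lambda>A. inf_residual C (pos_halfspace zs) A) ` \<A>)
       \<and> ((\<forall>A\<in>\<A>. cl_sum A (pos_halfspace zs) = A) \<longrightarrow>
           inf_residual C (pos_halfspace zs) (set_sup \<A>)
             = set_inf ((\<lambda>A. inf_residual C (pos_halfspace zs) A) ` \<A>))"
proof -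
  have cvx: "convex C" using C(1) by (simp add: convex_cone_def)
  have f: "zs \<in> dual_cone C" "zs \<noteq> (\<lambda>_. 0)" using zs by auto
  note H = pos_halfspace_in_upper_sets[OF cvx C(2) f(1)]
  show ?thesis
    using inf_residual_set_inf[OF cvx C(2) H] set_inf_residual_subset[OF cvx C(2) H]
      residual_set_sup_subset[OF cvx C(2) f]
    by (intro conjI impI antisym) auto
qed

end
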